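(* Let $a, d, r$ be real numbers with $a^2+4dr\neq 0$, and let $(x_n)_{n\ge 0}$ be a sequence of real numbers. Put $B=a^2+(a+d)r$ and $$\lambda_{1,2}=\frac{1}{2}\left(a+2r\pm\sqrt{a^2+4dr}\right),$$ where $\sqrt{a^2+4dr}$ denotes a fixed (possibly non-real) complex square root, so that $\lambda_1\neq\lambda_2$. Then $(x_n)_{n\ge0}$ satisfies the recurrence relation with coefficients in arithmetic-geometric progression $$x_{n+1}=\sum_{k=0}^{n}(a+kd)r^k x_{n-k}=ax_n+(a+d)r\,x_{n-1}+(a+2d)r^2x_{n-2}+\cdots+(a+nd)r^n x_0\qquad\text{for all } n\ge 0$$ if and only if $$x_n=\frac{x_0}{\lambda_1-\lambda_2}\left[\left(B-a\lambda_2\right)\lambda_1^{n-1}-\left(B-a\lambda_1\right)\lambda_2^{n-1}\right]\qquad\text{for all } n\ge 1.$$ In this case $(x_n)_{n\ge1}$ satisfies the second-order recurrence $x_{n+1}=(a+2r)x_n-(r^2+(a-d)r)x_{n-1}$ for $n\ge 2$.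
   Context: The initial value $x_0$ is arbitrary. The numbers $\lambda_1,\lambda_2$ are the roots of $\lambda^2-(a+2r)\lambda+(r^2+(a-d)r)=0$. *)

theory Defs
  imports Complex_Main
begin

end

theory Submission
  imports Defs
begin

text \<open>
  Besides $W_n = \sum_k (a + kd) r^k x_{n-k}$ consider the geometric convolution
  $S_n = \sum_k r^k x_{n-k}$. Shifting the summation index gives
  $S_{n+1} = x_{n+1} + r S_n$ and $W_{n+1} = a x_{n+1} + r (W_n + d S_n)$. Hence
  $x_{n+1} = W_n$ for all $n$ is equivalent to $x_1 = a x_0$ together with
  $x_{n+2} = (a + r) x_{n+1} + d r S_n$, and eliminating $S_n$ between consecutive instances
  leaves a second-order recurrence with $x_1 = a x_0$ and $x_2 = B x_0$. Its characteristic roots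
  $\lambda_1, \lambda_2$ are distinct, so Binet's formula applies.
\<close>

lemma sum_geometric_convolution_Suc:
  fixes r :: "'a::comm_semiring_1"
  shows "(\<Sum>k = 0..Suc n. r ^ k * x (Suc n - k)) = x (Suc n) + r * (\<Sum>k = 0..n. r ^ k * x (n - k))"
  by (simp add: sum.atLeast0_atMost_Suc_shift sum_distrib_left mult.assoc del: sum.cl_ivl_Suc)

text \<open>The term \<open>k = 0\<close> splits off; in the others
  \<open>a + (k + 1) * d = (a + k * d) + d\<close>, and the surplus \<open>d\<close> produces the
  geometric convolution.\<close>

lemma sum_arith_geometric_convolution_Suc:
  fixes a d r :: "'a::comm_semiring_1"
  shows "(\<Sum>k = 0..Suc n. (a + of_nat k * d) * r ^ k * x (Suc n - k)) =
    a * x (Suc n) + r * ((\<Sum>k = 0..n. (a + of_nat k * d) * r ^ k * x (n - k))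
      + d * (\<Sum>k = 0..n. r ^ k * x (n - k)))"
  by (simp add: sum.atLeast0_atMost_Suc_shift sum_distrib_left sum.distrib[symmetric] algebra_simps
      del: sum.cl_ivl_Suc)

text \<open>The second-order recurrence starts only at \<open>x 1\<close>: one step earlier it would
  give \<open>x 2 = (B - r\<^sup>2) * x 0\<close> with \<open>B = a\<^sup>2 + (a + d) * r\<close>,
  hence the separate condition on \<open>x 2\<close>.\<close>

lemma arith_geometric_recurrence_iff_second_order:
  fixes a d r :: "'a::comm_ring_1"
  shows "(\<forall>n. x (n + 1) = (\<Sum>k = 0..n. (a + of_nat k * d) * r ^ k * x (n - k))) \<longleftrightarrow>
    x 1 = a * x 0 \<and> x 2 = (a\<^sup>2 + (a + d) * r) * x 0 \<and>
    (\<forall>n. x (n + 3) = (a + 2 * r) * x (n + 2) - (r\<^sup>2 + (a - d) * r) * x (n + 1))"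
    (is "?R \<longleftrightarrow> ?Q")
proof -
  define S where "S n = (\<Sum>k = 0..n. r ^ k * x (n - k))" for n
  define W where "W n = (\<Sum>k = 0..n. (a + of_nat k * d) * r ^ k * x (n - k))" for n
  have S_Suc: "S (Suc n) = x (Suc n) + r * S n" for n
    unfolding S_def by (rule sum_geometric_convolution_Suc)
  have W_Suc: "W (Suc n) = a * x (Suc n) + r * (W n + d * S n)" for n
    unfolding W_def S_def by (rule sum_arith_geometric_convolution_Suc)
  have S0: "S 0 = x 0" and W0: "W 0 = a * x 0"
    by (simp_all add: S_def W_def)
  have "(\<forall>n. x (Suc n) = W n) \<longleftrightarrow> ?Q"
  proof
    assume R: "\<forall>n. x (Suc n) = W n"
    have first_order: "x (Suc (Suc n)) = (a + r) * x (Suc n) + d * r * S n" for n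
      using R W_Suc[of n] by (simp add: algebra_simps)
    have x1: "x 1 = a * x 0"
      using R W0 by simp
    have x2: "x 2 = (a\<^sup>2 + (a + d) * r) * x 0"
      using first_order[of 0] x1 S0 by (simp add: numeral_2_eq_2 power2_eq_square algebra_simps)
    have "x (n + 3) = (a + 2 * r) * x (n + 2) - (r\<^sup>2 + (a - d) * r) * x (n + 1)" for n
    proof -
      have "x (n + 3) = (a + r) * x (n + 2) + d * r * x (n + 1) + r * (d * r * S n)"
        using first_order[of "Suc n"] S_Suc[of n] by (simp add: numeral_3_eq_3 algebra_simps)
      \<comment> \<open>The product \<open>d * r * S n\<close> is eliminated as a whole, so nothing
        is divided by \<open>d * r\<close>, which may be zero.\<close>
      moreover have "d * r * S n = x (n + 2) - (a + r) * x (n + 1)"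
        using first_order[of n] by simp
      ultimately have "x (n + 3) = (a + r) * x (n + 2) + d * r * x (n + 1)
          + r * (x (n + 2) - (a + r) * x (n + 1))"
        by (simp only:)
      then show ?thesis
        by (simp add: power2_eq_square algebra_simps)
    qed
    with x1 x2 show ?Q by blast
  next
    assume Q: ?Q
    have first_order: "x (Suc (Suc n)) = (a + r) * x (Suc n) + d * r * S n" for n
    proof (induction n)
      case 0
      then show ?case
        using Q S0 by (simp add: numeral_2_eq_2 power2_eq_square algebra_simps)
    next
      case (Suc n)
      have "x (Suc (Suc (Suc n))) =
          (a + 2 * r) * x (Suc (Suc n)) - (r\<^sup>2 + (a - d) * r) * x (Suc n)"
        using Q by (simp add: numeral_3_eq_3)
      \<comment> \<open>The coefficients are regrouped so that the last bracket is
        \<open>d * r * S n\<close> by the induction hypothesis; then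
        \<open>x (Suc n) + r * S n\<close> is \<open>S (Suc n)\<close>.\<close>
      also have "\<dots> = (a + r) * x (Suc (Suc n)) + d * r * x (Suc n)
          + r * (x (Suc (Suc n)) - (a + r) * x (Suc n))"
        by (simp add: power2_eq_square algebra_simps)
      also have "\<dots> = (a + r) * x (Suc (Suc n)) + d * r * S (Suc n)"
        unfolding Suc.IH S_Suc by (simp add: algebra_simps)
      finally show ?case .
    qed
    have "x (Suc n) = W n" for n
    proof (induction n)
      case 0
      then show ?case using Q W0 by simp
    next
      case (Suc n)
      then show ?case
        using first_order[of n] W_Suc[of n] by (simp add: algebra_simps)
    qed
    then show "\<forall>n. x (Suc n) = W n" by blast
  qed
  then show ?thesis by (simp add: W_def)
qed

text \<open>Two initial values and the recurrence determine \<open>y\<close>, and the closed form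
  has the same initial values and satisfies the same recurrence, \<open>p\<close> and
  \<open>q\<close> being the roots of its characteristic polynomial.\<close>

lemma second_order_recurrence_iff_Binet:
  fixes p q :: "'a::field"
  assumes "p \<noteq> q"
  shows "y 0 = u \<and> y 1 = v \<and> (\<forall>n. y (n + 2) = (p + q) * y (n + 1) - p * q * y n) \<longleftrightarrow>
    (\<forall>n. y n = ((v - u * q) * p ^ n - (v - u * p) * q ^ n) / (p - q))"
    (is "?L \<longleftrightarrow> (\<forall>n. y n = ?b n)")
proof -
  have b0: "?b 0 = u" and b1: "?b 1 = v"
    using assms by (simp_all add: field_simps)
  have b_rec: "?b (n + 2) = (p + q) * ?b (n + 1) - p * q * ?b n" for n
    \<comment> \<open>Over the common denominator \<open>p - q\<close> only a polynomial identity
      between the numerators remains.\<close>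
    unfolding times_divide_eq_right diff_divide_distrib[symmetric]
    by (rule arg_cong[where f = "\<lambda>t. t / (p - q)"]) (simp add: algebra_simps)
  show ?thesis
  proof
    assume L: ?L
    have "y n = ?b n \<and> y (n + 1) = ?b (n + 1)" for n
    proof (induction n)
      case 0
      then show ?case using L b0 b1 by simp
    next
      case (Suc n)
      have "y (n + 2) = ?b (n + 2)"
        unfolding b_rec using L Suc.IH by metis
      then show ?case using Suc.IH by simp
    qed
    then show "\<forall>n. y n = ?b n" by blast
  next
    assume "\<forall>n. y n = ?b n"
    then show ?L using b0 b1 b_rec by metis
  qed
qed

theorem theorem2p1:
  fixes a d r B :: real
    and x :: "nat \<Rightarrow> real"
    and s lam1 lam2 :: complex
  assumes disc: "a\<^sup>2 + 4 * d * r \<noteq> 0"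
    and B: "B = a\<^sup>2 + (a + d) * r"
    and sqrt: "s\<^sup>2 = complex_of_real (a\<^sup>2 + 4 * d * r)"
    and lam1: "lam1 = (complex_of_real (a + 2 * r) + s) / 2"
    and lam2: "lam2 = (complex_of_real (a + 2 * r) - s) / 2"
  shows "lam1 \<noteq> lam2
    \<and> ((\<forall>n. x (n + 1) = (\<Sum>k = 0..n. (a + real k * d) * r ^ k * x (n - k)))
        \<longleftrightarrow>
       (\<forall>n\<ge>1. complex_of_real (x n) =
          complex_of_real (x 0) / (lam1 - lam2) *
            ((complex_of_real B - complex_of_real a * lam2) * lam1 ^ (n - 1)
             - (complex_of_real B - complex_of_real a * lam1) * lam2 ^ (n - 1))))
    \<and> ((\<forall>n. x (n + 1) = (\<Sum>k = 0..n. (a + real k * d) * r ^ k * x (n - k)))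
        \<longrightarrow>
       (\<forall>n\<ge>2. x (n + 1) = (a + 2 * r) * x n - (r\<^sup>2 + (a - d) * r) * x (n - 1)))"
proof -
  let ?R = "\<forall>n. x (n + 1) = (\<Sum>k = 0..n. (a + real k * d) * r ^ k * x (n - k))"
  let ?rec = "\<lambda>n. x (n + 3) = (a + 2 * r) * x (n + 2) - (r\<^sup>2 + (a - d) * r) * x (n + 1)"
  have R_iff: "?R \<longleftrightarrow> x 1 = a * x 0 \<and> x 2 = B * x 0 \<and> (\<forall>n. ?rec n)"
    unfolding B by (rule arith_geometric_recurrence_iff_second_order)
  have "s\<^sup>2 \<noteq> 0"
    unfolding sqrt using disc by (simp only: of_real_eq_0_iff not_False_eq_True)
  then have "s \<noteq> 0" by simp
  moreover have diff: "lam1 - lam2 = s"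
    unfolding lam1 lam2 by (simp add: field_simps)
  ultimately have neq: "lam1 \<noteq> lam2" by auto
  have sum_roots: "lam1 + lam2 = of_real (a + 2 * r)"
    unfolding lam1 lam2 by (simp add: field_simps)
  \<comment> \<open>A difference of squares: the product depends only on \<open>s\<^sup>2\<close>,
    so it is real whichever square root \<open>s\<close> is.\<close>
  have "4 * (lam1 * lam2) = (of_real (a + 2 * r))\<^sup>2 - s\<^sup>2"
    unfolding lam1 lam2 by (simp add: power2_eq_square field_simps)
  also have "\<dots> = 4 * of_real (r\<^sup>2 + (a - d) * r)"
    unfolding sqrt by (simp add: power2_eq_square algebra_simps)
  finally have prod_roots: "lam1 * lam2 = of_real (r\<^sup>2 + (a - d) * r)"
    by (simp only: mult_cancel_left) simp
  \<comment> \<open>The shift makes \<open>y\<close> start at \<open>x 1\<close>, where the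
    recurrence begins; the embedding into the complex numbers is injective, so the equivalence
    survives it.\<close>
  define y where "y n = complex_of_real (x (n + 1))" for n
  have "?R \<longleftrightarrow> y 0 = of_real (a * x 0) \<and> y 1 = of_real (B * x 0) \<and>
      (\<forall>n. y (n + 2) = (lam1 + lam2) * y (n + 1) - lam1 * lam2 * y n)"
    unfolding R_iff sum_roots prod_roots y_def
      of_real_mult[symmetric] of_real_diff[symmetric] of_real_eq_iff
    by (simp add: numeral_2_eq_2 numeral_3_eq_3)
  also have "\<dots> \<longleftrightarrow> (\<forall>n. y n = ((of_real (B * x 0) - of_real (a * x 0) * lam2) * lam1 ^ n
      - (of_real (B * x 0) - of_real (a * x 0) * lam1) * lam2 ^ n) / (lam1 - lam2))"
    by (rule second_order_recurrence_iff_Binet[OF neq])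
  also have "\<dots> \<longleftrightarrow> (\<forall>n. complex_of_real (x (Suc n)) = of_real (x 0) / (lam1 - lam2) *
      ((of_real B - of_real a * lam2) * lam1 ^ n - (of_real B - of_real a * lam1) * lam2 ^ n))"
    by (simp add: y_def algebra_simps diff_divide_distrib add_divide_distrib)
  \<comment> \<open>Undoes the shift; for \<open>n \<ge> 1\<close> the natural subtraction
    \<open>n - 1\<close> is not truncated.\<close>
  also have "\<dots> \<longleftrightarrow> (\<forall>n\<ge>1. complex_of_real (x n) = of_real (x 0) / (lam1 - lam2) *
      ((of_real B - of_real a * lam2) * lam1 ^ (n - 1)
        - (of_real B - of_real a * lam1) * lam2 ^ (n - 1)))"
    by (metis One_nat_def Suc_le_D diff_Suc_1 le_add1 plus_1_eq_Suc)
  finally have closed_form: "?R \<longleftrightarrow> \<dots>" .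
  have "x (n + 1) = (a + 2 * r) * x n - (r\<^sup>2 + (a - d) * r) * x (n - 1)" if ?R "n \<ge> 2" for n
  proof -
    obtain m where "n = m + 2" using \<open>n \<ge> 2\<close> by (metis add.commute le_Suc_ex)
    moreover have "?rec m" using \<open>?R\<close> R_iff by blast
    ultimately show ?thesis by (simp add: numeral_3_eq_3)
  qed
  with neq closed_form show ?thesis by blast
qed

end
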